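(* For all positive integers $k$ and $n$, $$\Phi_k(n)\le\left(\frac{e\,\pi^2\,\lfloor (k+1)/2\rfloor\,k!}{2^{k+2}}\right)^{1/k} n^{1/k}+\frac{e-1}{e}\,k.$$
   Context: A finite set $\mathcal A$ of non-negative integers is a $B_k$-sequence if all sums $a_1+\dots+a_k$ of $k$ elements of $\mathcal A$ (repetitions allowed) are different, i.e. distinct multisets $\{a_1,\dots,a_k\}$ of elements of $\mathcal A$ have distinct sums. $\Phi_k(n)$ is the maximum size of a $B_k$-sequence contained in $[0,n]$. *)

theory Defs
  imports "HOL-Analysis.Analysis" "HOL-Library.Multiset"
begin

definition B_seq :: "nat \<Rightarrow> nat set \<Rightarrow> bool" where
  "B_seq k A \<longleftrightarrow> finite A \<and>
     (\<forall>M N. set_mset M \<subseteq> A \<and> set_mset N \<subseteq> A \<and> size M = k \<and> size N = k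
        \<and> sum_mset M = sum_mset N \<longrightarrow> M = N)"

definition Phi :: "nat \<Rightarrow> nat \<Rightarrow> nat" where
  "Phi k n = Max {card A | A. A \<subseteq> {0..n} \<and> B_seq k A}"

end

theory Submission
  imports Defs "HOL-Library.Ramsey"
begin

text \<open>
  Let \<open>A \<subseteq> [0,n]\<close> be a \<open>B\<^sub>k\<close>-sequence with \<open>a\<close> elements, \<open>m = \<lfloor>k/2\<rfloor>\<close> and \<open>h = \<lceil>k/2\<rceil>\<close>.
  For disjoint \<open>P, Q \<subseteq> A\<close> with \<open>|P| = m\<close> and \<open>|Q| = h\<close> the differences \<open>\<Sum>P - \<Sum>Q\<close> are
  pairwise distinct. For a fixed union \<open>P \<union> Q\<close>, nearly balanced random signs are negatively
  correlated, so after translating \<open>A\<close> into \<open>[-n/2, n/2]\<close> the mean square of the differences is of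
  order \<open>k n\<^sup>2\<close>; on the other hand, \<open>N\<close> distinct integers have variance at least \<open>(N\<^sup>2 - 1)/12\<close>.
  Hence \<open>binom(a,k) binom(k,m)\<close> is \<open>O(n \<surd>k)\<close>, and \<open>4\<^sup>k \<le> 4 h binom(k,m)\<^sup>2\<close> turns this into
  \<open>2\<^sup>k binom(a,k) \<le> 6 h n\<close>; note \<open>6 \<le> e \<pi>\<^sup>2 / 4\<close>.

  The linear term comes from \<open>(y + k/e)\<^sup>k \<le> (y + 1) \<cdots> (y + k)\<close>, used with \<open>y = a - k\<close> when \<open>a \<ge> k\<close>.
  If \<open>a < k\<close>, then \<open>t = a - k + k/e\<close> satisfies \<open>2t \<le> a - 1 + k/e\<close>, and \<open>y = a - 1\<close> bounds \<open>(2t)\<^sup>k\<close>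
  by \<open>k!\<close> times the number of \<open>k\<close>-element multisets over \<open>A\<close>, whose sums are distinct numbers up
  to \<open>k n\<close>.
\<close>

lemma card_le_Max_diff_Min:
  fixes X :: "int set"
  assumes "finite X" "X \<noteq> {}"
  shows "int (card X) \<le> Max X - Min X + 1"
proof -
  have "X \<subseteq> {Min X..Max X}" using assms by auto
  then have "card X \<le> card {Min X..Max X}" by (intro card_mono) auto
  moreover have "Min X \<le> Max X" using assms by simp
  ultimately show ?thesis by simp
qed

lemma sum_square_distinct_integers_ge:
  fixes X :: "int set" and c :: real
  assumes "finite X"
  shows "real (card X) * ((real (card X))\<^sup>2 - 1) / 12 \<le> (\<Sum>s\<in>X. (real_of_int s - c)\<^sup>2)"
  using assms
proof (induction "card X" arbitrary: X rule: less_induct)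
  case less
  show ?case
  proof (cases "card X \<le> 1")
    case True
    then have "card X = 0 \<or> card X = 1" by linarith
    then show ?thesis by (auto intro!: sum_nonneg)
  next
    case False
    define p q Y where "p = Min X" and "q = Max X" and "Y = X - {p, q}"
    have "X \<noteq> {}" using False by auto
    then have mem: "p \<in> X" "q \<in> X" and width: "int (card X) \<le> q - p + 1"
      using less.prems card_le_Max_diff_Min by (auto simp: p_def q_def)
    with False have "p < q" by linarith
    then have card_X: "card X = card Y + 2"
      using False mem less.prems unfolding Y_def by (subst card_Diff_subset) auto
    have "(real (card Y) + 1)\<^sup>2 \<le> (real_of_int q - real_of_int p)\<^sup>2"
      using width card_X by (intro power_mono) linarith+
    also have "\<dots> \<le> 2 * ((p - c)\<^sup>2 + (q - c)\<^sup>2)"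
      using zero_le_power2[of "(p - c) + (q - c)"] by (simp add: power2_eq_square algebra_simps)
    finally have ends: "(real (card Y) + 1)\<^sup>2 / 2 \<le> (p - c)\<^sup>2 + (q - c)\<^sup>2" by simp
    have "real (card X) * ((real (card X))\<^sup>2 - 1) / 12 =
        real (card Y) * ((real (card Y))\<^sup>2 - 1) / 12 + (real (card Y) + 1)\<^sup>2 / 2"
      by (simp add: card_X power2_eq_square field_simps)
    also have "\<dots> \<le> (\<Sum>s\<in>Y. (real_of_int s - c)\<^sup>2) + ((p - c)\<^sup>2 + (q - c)\<^sup>2)"
      using less.hyps[of Y] card_X less.prems ends by (intro add_mono) (auto simp: Y_def)
    also have "\<dots> = (\<Sum>s\<in>X. (real_of_int s - c)\<^sup>2)"
      using sum.subset_diff[of "{p, q}" X "\<lambda>s. (real_of_int s - c)\<^sup>2"] less.prems mem \<open>p < q\<close>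
      by (simp add: Y_def)
    finally show ?thesis .
  qed
qed

definition signed_sum :: "('a \<Rightarrow> 'b::ab_group_add) \<Rightarrow> 'a set \<Rightarrow> 'a set \<Rightarrow> 'b" where
  "signed_sum x T P = sum x P - sum x (T - P)"

lemma signed_sum_diff_const:
  fixes x :: "'a \<Rightarrow> 'b::ring_1"
  assumes "finite T" "P \<in> nsets T m"
  shows "signed_sum (\<lambda>i. x i - c) T P = signed_sum x T P - (2 * of_nat m - of_nat (card T)) * c"
proof -
  have "finite P" "P \<subseteq> T" "card P = m" "card (T - P) = card T - m" "m \<le> card T"
    using assms by (auto simp: nsets_def card_Diff_subset card_mono)
  then show ?thesis by (simp add: signed_sum_def sum_subtractf mult_2 algebra_simps)
qed

definition subset_sign :: "'a set \<Rightarrow> 'a \<Rightarrow> 'b::comm_ring_1" where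
  "subset_sign P i = (if i \<in> P then 1 else -1)"

lemma signed_sum_eq_sum_subset_sign:
  fixes x :: "'a \<Rightarrow> 'b::comm_ring_1"
  assumes "finite T" "P \<subseteq> T"
  shows "signed_sum x T P = (\<Sum>i\<in>T. subset_sign P i * x i)"
proof -
  have "(\<Sum>i\<in>T. subset_sign P i * x i) =
      (\<Sum>i\<in>T - P. subset_sign P i * x i) + (\<Sum>i\<in>P. subset_sign P i * x i)"
    using assms by (intro sum.subset_diff)
  also have "\<dots> = - sum x (T - P) + sum x P"
    by (simp add: subset_sign_def sum_negf)
  finally show ?thesis by (simp add: signed_sum_def)
qed

lemma card_nsets_separating:
  assumes "finite T" "i \<in> T" "j \<in> T" "i \<noteq> j" "m \<ge> 1"
  shows "card {P \<in> nsets T m. i \<in> P \<and> j \<notin> P} = (card T - 2) choose (m - 1)"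
proof -
  have "{P \<in> nsets T m. i \<in> P \<and> j \<notin> P} = insert i ` nsets (T - {i, j}) (m - 1)"
  proof (intro equalityI subsetI)
    fix P assume "P \<in> {P \<in> nsets T m. i \<in> P \<and> j \<notin> P}"
    then have "P = insert i (P - {i})" "P - {i} \<in> nsets (T - {i, j}) (m - 1)"
      by (auto simp: nsets_def)
    then show "P \<in> insert i ` nsets (T - {i, j}) (m - 1)" by (rule image_eqI)
  next
    fix P assume "P \<in> insert i ` nsets (T - {i, j}) (m - 1)"
    then obtain R where "P = insert i R" "R \<in> nsets (T - {i, j}) (m - 1)" by blast
    moreover from this have "i \<notin> R" by (auto simp: nsets_def)
    ultimately show "P \<in> {P \<in> nsets T m. i \<in> P \<and> j \<notin> P}"
      using assms by (auto simp: nsets_def)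
  qed
  moreover have "inj_on (insert i) (nsets (T - {i, j}) (m - 1))"
    by (rule inj_onI) (auto simp: nsets_def insert_ident)
  moreover have "card (T - {i, j}) = card T - 2"
    using assms by (subst card_Diff_subset) auto
  ultimately show ?thesis by (simp add: card_image)
qed

lemma sum_subset_sign_product:
  assumes "finite T" "m \<ge> 1" "i \<in> T" "j \<in> T" "i \<noteq> j"
  shows "(\<Sum>P\<in>nsets T m. subset_sign P i * subset_sign P j) =
    (of_nat (card T choose m) - 4 * of_nat ((card T - 2) choose (m - 1)) :: 'b::comm_ring_1)"
proof -
  have product: "subset_sign P i * subset_sign P j =
      (1 - 2 * of_bool (i \<in> P \<and> j \<notin> P) - 2 * of_bool (j \<in> P \<and> i \<notin> P) :: 'b)" for P
    by (auto simp: subset_sign_def)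
  have separating: "(\<Sum>P\<in>nsets T m. of_bool (a \<in> P \<and> b \<notin> P)) =
      (of_nat ((card T - 2) choose (m - 1)) :: 'b)" if "a \<in> T" "b \<in> T" "a \<noteq> b" for a b
    using card_nsets_separating[OF assms(1) that assms(2)] assms(1)
    by (simp add: finite_imp_finite_nsets Int_def)
  show ?thesis
    using assms by (simp add: product sum_subtractf separating flip: sum_distrib_left)
qed

lemma sum_square_signed_sum:
  fixes x :: "'a \<Rightarrow> 'b::comm_ring_1"
  assumes "finite T" "m \<ge> 1"
  defines "C \<equiv> of_nat (card T choose m) :: 'b"
    and "D \<equiv> 4 * of_nat ((card T - 2) choose (m - 1)) :: 'b"
  shows "(\<Sum>P\<in>nsets T m. (signed_sum x T P)\<^sup>2) = D * (\<Sum>i\<in>T. (x i)\<^sup>2) + (C - D) * (sum x T)\<^sup>2"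
proof -
  let ?s = subset_sign
  have correlation: "(\<Sum>P\<in>nsets T m. ?s P i * ?s P j) = C - D + (if i = j then D else 0)"
    if "i \<in> T" "j \<in> T" for i j
  proof (cases "i = j")
    case True
    have "?s P i * ?s P i = (1 :: 'b)" for P by (simp add: subset_sign_def)
    with True show ?thesis by (simp add: C_def)
  next
    case False
    then show ?thesis using sum_subset_sign_product[of T m i j] assms that by simp
  qed
  have "(\<Sum>P\<in>nsets T m. (signed_sum x T P)\<^sup>2) =
      (\<Sum>P\<in>nsets T m. \<Sum>i\<in>T. \<Sum>j\<in>T. ?s P i * ?s P j * (x i * x j))"
    using \<open>finite T\<close>
    by (intro sum.cong refl)
      (simp add: nsets_def signed_sum_eq_sum_subset_sign power2_eq_square sum_product mult_ac)
  also have "\<dots> = (\<Sum>i\<in>T. \<Sum>j\<in>T. (\<Sum>P\<in>nsets T m. ?s P i * ?s P j) * (x i * x j))"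
    unfolding sum_distrib_right by (subst sum.swap) (intro sum.cong refl, rule sum.swap)
  also have "\<dots> = (\<Sum>i\<in>T. \<Sum>j\<in>T. (C - D) * (x i * x j) + (if i = j then D * (x i * x j) else 0))"
    by (intro sum.cong refl) (simp add: correlation distrib_right)
  also have "\<dots> = D * (\<Sum>i\<in>T. (x i)\<^sup>2) + (C - D) * (sum x T)\<^sup>2"
    using \<open>finite T\<close>
    by (simp add: sum.distrib power2_eq_square sum_product flip: sum_distrib_left)
  finally show ?thesis .
qed

lemma binomial_absorb_twice:
  assumes "1 \<le> m" "m \<le> k"
  shows "k * (k - 1) * ((k - 2) choose (m - 1)) = m * (k - m) * (k choose m)"
proof -
  have "k * (k - 1) * ((k - 2) choose (m - 1)) =
      k * ((k - 1 - (m - 1)) * ((k - 1) choose (m - 1)))"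
    by (simp only: binomial_absorb_comp) (simp add: numeral_2_eq_2)
  also have "\<dots> = (k - m) * (k * ((k - 1) choose (m - 1)))"
    using assms by (simp add: mult_ac)
  also have "k * ((k - 1) choose (m - 1)) = m * (k choose m)"
    using assms by (simp add: times_binomial_minus1_eq)
  finally show ?thesis by (simp add: mult_ac)
qed

lemma choose_half_le:
  assumes "k \<ge> 2"
  shows "k choose (k div 2) \<le> 4 * ((k - 2) choose (k div 2 - 1))"
proof -
  define m where "m = k div 2"
  have "k * (k - 1) \<le> 4 * (m * (k - m))"
    by (cases "even k") (auto simp: m_def elim!: evenE oddE)
  then have "k * (k - 1) * (k choose m) \<le> 4 * (m * (k - m)) * (k choose m)"
    by (rule mult_right_mono) simp
  also have "\<dots> = k * (k - 1) * (4 * ((k - 2) choose (m - 1)))"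
    using binomial_absorb_twice[of m k] assms by (simp add: m_def mult_ac)
  finally show ?thesis using assms by (simp add: m_def)
qed

lemma choose_half_ge:
  assumes "k \<ge> 3"
  shows "3 * k * ((k - 2) choose (k div 2 - 1)) \<le> 2 * ((k + 1) div 2) * (k choose (k div 2))"
proof -
  define m h where "m = k div 2" and "h = (k + 1) div 2"
  have "3 * (m * (k - m)) \<le> 2 * h * (k - 1)"
  proof (cases "even k")
    case True
    then have "k = 2 * m" "h = m" by (auto simp: m_def h_def)
    moreover from this assms obtain i where "m = 2 + i"
      using le_Suc_ex[of 2 m] by auto
    ultimately show ?thesis by (simp add: algebra_simps)
  next
    case False
    then have "k = 2 * m + 1" "h = m + 1" by (auto simp: m_def h_def elim!: oddE)
    then show ?thesis by (simp add: algebra_simps)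
  qed
  then have product: "3 * (m * (k - m)) * (k choose m) \<le> 2 * h * (k - 1) * (k choose m)"
    by (rule mult_right_mono) simp
  have absorb: "k * (k - 1) * ((k - 2) choose (m - 1)) = m * (k - m) * (k choose m)"
    using assms by (intro binomial_absorb_twice) (auto simp: m_def)
  have "(k - 1) * (3 * k * ((k - 2) choose (m - 1))) = 3 * (k * (k - 1) * ((k - 2) choose (m - 1)))"
    by (simp only: mult_ac)
  also have "\<dots> = 3 * (m * (k - m)) * (k choose m)"
    unfolding absorb by (simp only: mult_ac)
  also have "\<dots> \<le> (k - 1) * (2 * h * (k choose m))"
    using product by (simp only: mult_ac)
  finally show ?thesis
    unfolding m_def h_def by (rule mult_left_le_imp_le) (use assms in simp)
qed

lemma sum_square_signed_sum_half_le:
  fixes x :: "'a \<Rightarrow> real"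
  assumes "finite T" "card T = k" "k \<ge> 3" and bounded: "\<And>i. i \<in> T \<Longrightarrow> \<bar>x i\<bar> \<le> r"
  shows "(\<Sum>P\<in>nsets T (k div 2). (signed_sum x T P)\<^sup>2)
    \<le> 8 / 3 * real ((k + 1) div 2) * real (k choose (k div 2)) * r\<^sup>2"
proof -
  define C E where "C = k choose (k div 2)" and "E = (k - 2) choose (k div 2 - 1)"
  have "C \<le> 4 * E"
    using choose_half_le[of k] assms by (simp add: C_def E_def)
  then have negative_correlation: "real C - 4 * real E \<le> 0" by linarith
  have "(\<Sum>P\<in>nsets T (k div 2). (signed_sum x T P)\<^sup>2) =
      4 * real E * (\<Sum>i\<in>T. (x i)\<^sup>2) + (real C - 4 * real E) * (sum x T)\<^sup>2"
    using sum_square_signed_sum[of T "k div 2" x] assms by (simp add: C_def E_def)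
  also have "\<dots> \<le> 4 * real E * (\<Sum>i\<in>T. (x i)\<^sup>2)"
    using negative_correlation by (simp add: mult_nonpos_nonneg)
  also have "\<dots> \<le> 4 * real E * (real k * r\<^sup>2)"
  proof (rule mult_left_mono)
    show "(\<Sum>i\<in>T. (x i)\<^sup>2) \<le> real k * r\<^sup>2"
      using bounded assms(2) sum_bounded_above[of T "\<lambda>i. (x i)\<^sup>2" "r\<^sup>2"]
      by (metis abs_ge_zero power2_abs power_mono)
  qed simp
  also have "\<dots> = 4 / 3 * real (3 * k * E) * r\<^sup>2" by simp
  also have "\<dots> \<le> 4 / 3 * real (2 * ((k + 1) div 2) * C) * r\<^sup>2"
    using choose_half_ge[OF \<open>k \<ge> 3\<close>] unfolding C_def E_def
    by (intro mult_left_mono mult_right_mono of_nat_mono) auto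
  finally show ?thesis by (simp add: C_def mult.assoc)
qed

lemma choose_half_square_ge:
  assumes "k \<ge> 1"
  shows "4 ^ k \<le> 4 * ((k + 1) div 2) * (k choose (k div 2))\<^sup>2"
  using assms
proof (induction k rule: nat_induct_at_least)
  case base
  show ?case by simp
next
  case (Suc k)
  define m where "m = k div 2"
  show ?case
  proof (cases "even k")
    case True
    then have k: "k = 2 * m" by (simp add: m_def)
    have absorb: "(m + 1) * (Suc k choose m) = Suc k * (k choose m)"
      using binomial_absorb_comp[of "Suc k" m] by (simp add: k)
    have "4 ^ k \<le> 4 * m * (k choose m)\<^sup>2"
      using Suc.IH by (simp add: k)
    then have "(m + 1) * 4 ^ Suc k \<le> (m + 1) * (4 * (4 * m * (k choose m)\<^sup>2))"
      by (simp only: power_Suc mult_left_mono)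
    also have "\<dots> \<le> 4 * (Suc k * (k choose m))\<^sup>2"
      by (simp add: k power2_eq_square algebra_simps)
    also have "\<dots> = (m + 1) * (4 * (m + 1) * (Suc k choose m)\<^sup>2)"
      unfolding absorb[symmetric] by (simp add: power2_eq_square algebra_simps)
    finally have "4 ^ Suc k \<le> 4 * (m + 1) * (Suc k choose m)\<^sup>2"
      by (rule mult_left_le_imp_le) simp
    then show ?thesis by (simp add: k)
  next
    case False
    then have k: "k = 2 * m + 1" by (auto simp: m_def elim!: oddE)
    have choose: "Suc k choose Suc m = 2 * (k choose m)"
      using central_binomial_odd[OF False] by (simp add: m_def)
    have "4 ^ k \<le> 4 * (m + 1) * (k choose m)\<^sup>2"
      using Suc.IH by (simp add: k)
    then have "4 ^ Suc k \<le> 4 * (m + 1) * (Suc k choose Suc m)\<^sup>2"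
      unfolding choose by (simp add: power_mult_distrib)
    then show ?thesis by (simp add: k del: binomial_Suc_Suc)
  qed
qed

lemma Mahler_inequality:
  fixes a b :: "'a \<Rightarrow> real"
  assumes "finite S" "S \<noteq> {}" and nonneg: "\<And>i. i \<in> S \<Longrightarrow> a i \<ge> 0" "\<And>i. i \<in> S \<Longrightarrow> b i \<ge> 0"
  shows "root (card S) (prod a S) + root (card S) (prod b S)
    \<le> root (card S) (\<Prod>i\<in>S. a i + b i)"
proof (cases "\<exists>i\<in>S. a i + b i = 0")
  case True
  then obtain i where "i \<in> S" "a i + b i = 0" by blast
  moreover from this have "a i = 0" "b i = 0" using nonneg[of i] by linarith+
  ultimately have "prod a S = 0" "prod b S = 0" "(\<Prod>i\<in>S. a i + b i) = 0"
    using \<open>finite S\<close> by (auto intro!: bexI[of _ i])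
  then show ?thesis by simp
next
  case False
  define c where "c = (\<lambda>i. a i + b i)"
  have c_pos: "c i > 0" if "i \<in> S" for i
    using that False nonneg[of i] by (force simp: c_def)
  have card_pos: "card S > 0" using assms(1,2) by (simp add: card_gt_0_iff)
  have weights: "a i / c i + b i / c i = 1" if "i \<in> S" for i
    using c_pos[OF that] by (simp add: c_def flip: add_divide_distrib)
  have amgm: "root (card S) (prod f S) / root (card S) (prod c S) \<le> (\<Sum>i\<in>S. f i / c i / card S)"
    if "\<And>i. i \<in> S \<Longrightarrow> f i \<ge> 0" for f
    using arith_geom_mean[OF assms(1,2), of "\<lambda>i. f i / c i"] that c_pos card_pos
    unfolding real_root_divide[symmetric] prod_dividef[symmetric]
    by (simp add: root_powr_inverse prod_nonneg less_imp_le)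
  have "(root (card S) (prod a S) + root (card S) (prod b S)) / root (card S) (prod c S)
      \<le> (\<Sum>i\<in>S. a i / c i / card S) + (\<Sum>i\<in>S. b i / c i / card S)"
    unfolding add_divide_distrib using nonneg by (intro add_mono amgm)
  also have "\<dots> = (\<Sum>i\<in>S. (a i / c i + b i / c i) / card S)"
    by (simp add: sum.distrib add_divide_distrib)
  also have "\<dots> = 1" using weights card_pos by simp
  finally have "(root (card S) (prod a S) + root (card S) (prod b S)) / root (card S) (prod c S) \<le> 1" .
  moreover have "root (card S) (prod c S) > 0" using c_pos card_pos by (simp add: prod_pos)
  ultimately show ?thesis unfolding c_def by (simp only: pos_divide_le_eq mult_1)
qed

lemma power_divide_exp_le_fact: "(real k / exp 1) ^ k \<le> fact k"
proof -
  have "real k ^ k / fact k \<le> exp (real k)"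
    using sum_le_suminf[OF summable_exp[of "real k"], of "{k}"]
    by (simp add: exp_def field_simps)
  then show ?thesis by (simp add: field_simps flip: exp_of_nat_mult)
qed

text \<open>
  Mahler's inequality separates \<open>x + i\<close> into \<open>x\<close> and \<open>i\<close>, which leaves \<open>(k/e)\<^sup>k \<le> k!\<close>.
\<close>

lemma power_le_pochhammer:
  fixes x :: real
  assumes "x \<ge> 0"
  shows "(x + real k / exp 1) ^ k \<le> pochhammer (x + 1) k"
proof (cases "k = 0")
  case False
  have "x + real k / exp 1 = root k (x ^ k) + root k ((real k / exp 1) ^ k)"
    using False assms by (simp add: real_root_power_cancel)
  also have "\<dots> \<le> root k (x ^ k) + root k (fact k)"
    using False power_divide_exp_le_fact by simp
  also have "\<dots> = root k (\<Prod>i\<in>{0..<k}. x) + root k (\<Prod>i\<in>{0..<k}. 1 + real i)"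
    by (simp add: pochhammer_fact pochhammer_prod)
  also have "\<dots> \<le> root k (\<Prod>i\<in>{0..<k}. x + (1 + real i))"
    using Mahler_inequality[of "{0..<k}" "\<lambda>_. x" "\<lambda>i. 1 + real i"] False assms by simp
  also have "\<dots> = root k (pochhammer (x + 1) k)"
    by (simp add: pochhammer_prod add.assoc)
  finally have "(x + real k / exp 1) ^ k \<le> root k (pochhammer (x + 1) k) ^ k"
    using assms by (intro power_mono) auto
  then show ?thesis using False assms by (simp add: pochhammer_nonneg)
qed simp

lemma power_le_fact_times_binomial:
  "(real y + real k / exp 1) ^ k \<le> fact k * real ((y + k) choose k)"
proof -
  have "pochhammer (real y + 1) k = fact k * real ((y + k) choose k)"
    by (simp add: binomial_gbinomial gbinomial_pochhammer')
  then show ?thesis using power_le_pochhammer[of "real y" k] by simp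
qed

lemma B_seq_multichoose_le:
  assumes "B_seq k A" "A \<subseteq> {0..n}"
  shows "(card A + k - 1) choose k \<le> k * n + 1"
proof -
  have "inj_on sum_mset (multisets_of_size A k)"
    using assms(1) unfolding inj_on_def multisets_of_size_def B_seq_def by blast
  moreover have "sum_mset ` multisets_of_size A k \<subseteq> {0..k * n}"
  proof clarsimp
    fix M assume M: "M \<in> multisets_of_size A k"
    then have "\<forall>x\<in>#M. x \<le> n"
      using assms(2) by (auto simp: multisets_of_size_def)
    then have "sum_mset M \<le> size M * n" by (induction M) auto
    then show "sum_mset M \<le> k * n" using M by (simp add: multisets_of_size_def)
  qed
  ultimately have "card (multisets_of_size A k) \<le> card {0..k * n}"
    by (intro card_inj_on_le) auto
  then show ?thesis using assms(1) by (simp add: B_seq_def card_multisets_of_size)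
qed

text \<open>
  A pair \<open>(T, P)\<close> stands for the ordered partition of \<open>T\<close> into \<open>P\<close> and \<open>T - P\<close>.
\<close>

definition nested_nsets :: "'a set \<Rightarrow> nat \<Rightarrow> nat \<Rightarrow> ('a set \<times> 'a set) set" where
  "nested_nsets A k m = (SIGMA T:nsets A k. nsets T m)"

lemma finite_nested_nsets: "finite A \<Longrightarrow> finite (nested_nsets A k m)"
  unfolding nested_nsets_def
  by (intro finite_SigmaI finite_imp_finite_nsets) (auto simp: nsets_def)

lemma card_nested_nsets:
  assumes "finite A"
  shows "card (nested_nsets A k m) = (card A choose k) * (k choose m)"
proof -
  have "card (nested_nsets A k m) = (\<Sum>T\<in>nsets A k. card (nsets T m))"
    unfolding nested_nsets_def using assms
    by (intro card_SigmaI finite_imp_finite_nsets ballI) (auto simp: nsets_def)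
  also have "\<dots> = (\<Sum>T\<in>nsets A k. k choose m)"
    by (intro sum.cong refl) (simp add: nsets_def[of A])
  finally show ?thesis by simp
qed

lemma sum_square_centred_signed_sum_le:
  fixes x :: "'a \<Rightarrow> real"
  assumes "finite A" "k \<ge> 3" and bounded: "\<And>a. a \<in> A \<Longrightarrow> \<bar>x a - c\<bar> \<le> r"
  defines "m \<equiv> k div 2" and "h \<equiv> (k + 1) div 2"
  shows "(\<Sum>(T, P)\<in>nested_nsets A k m. (signed_sum x T P - (2 * real m - real k) * c)\<^sup>2)
    \<le> real (card (nested_nsets A k m)) * (8 / 3 * real h * r\<^sup>2)"
proof -
  have "(\<Sum>(T, P)\<in>nested_nsets A k m. (signed_sum x T P - (2 * real m - real k) * c)\<^sup>2) =
      (\<Sum>T\<in>nsets A k. \<Sum>P\<in>nsets T m. (signed_sum x T P - (2 * real m - real k) * c)\<^sup>2)"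
    unfolding nested_nsets_def using \<open>finite A\<close>
    by (intro sum.Sigma[symmetric] finite_imp_finite_nsets ballI) (auto simp: nsets_def)
  also have "\<dots> = (\<Sum>T\<in>nsets A k. \<Sum>P\<in>nsets T m. (signed_sum (\<lambda>a. x a - c) T P)\<^sup>2)"
    by (intro sum.cong refl) (simp add: nsets_def[of A] signed_sum_diff_const)
  also have "\<dots> \<le> (\<Sum>T\<in>nsets A k. 8 / 3 * real h * real (k choose m) * r\<^sup>2)"
    unfolding m_def h_def using bounded \<open>k \<ge> 3\<close>
    by (intro sum_mono sum_square_signed_sum_half_le) (auto simp: nsets_def)
  also have "\<dots> = real (card (nested_nsets A k m)) * (8 / 3 * real h * r\<^sup>2)"
    by (simp add: card_nested_nsets[OF \<open>finite A\<close>])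
  finally show ?thesis .
qed

lemma B_seq_inj_on_signed_sum:
  assumes "B_seq k A" "m \<le> k"
  shows "inj_on (\<lambda>(T, P). signed_sum int T P) (nested_nsets A k m)"
proof (rule inj_onI, clarify)
  fix T P U Q
  assume mem: "(T, P) \<in> nested_nsets A k m" "(U, Q) \<in> nested_nsets A k m"
    and eq: "signed_sum int T P = signed_sum int U Q"
  define M N where "M = mset_set P + mset_set (U - Q)" and "N = mset_set Q + mset_set (T - P)"
  have sub: "T \<subseteq> A" "P \<subseteq> T" "U \<subseteq> A" "Q \<subseteq> U" and fin: "finite T" "finite P" "finite U" "finite Q"
    and card: "card T = k" "card P = m" "card U = k" "card Q = m"
    using mem by (auto simp: nested_nsets_def nsets_def)
  have set_M: "set_mset M = P \<union> (U - Q)" and set_N: "set_mset N = Q \<union> (T - P)"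
    using fin by (simp_all add: M_def N_def)
  have "int (sum_mset M) = int (sum_mset N)"
    using eq by (simp add: M_def N_def signed_sum_def sum_unfold_sum_mset)
  then have "sum_mset M = sum_mset N" by (simp only: of_nat_eq_iff)
  moreover have "size M = k" "size N = k"
    using sub fin card \<open>m \<le> k\<close> by (auto simp: M_def N_def card_Diff_subset)
  moreover have "set_mset M \<subseteq> A" "set_mset N \<subseteq> A"
    using sub by (auto simp: set_M set_N)
  ultimately have "M = N" using \<open>B_seq k A\<close> unfolding B_seq_def by simp
  then have "P \<union> (U - Q) = Q \<union> (T - P)" using set_M set_N by simp
  then show "T = U \<and> P = Q" using sub by blast
qed

lemma B_seq_card_nested_nsets_le:
  assumes B: "B_seq k A" and A: "A \<subseteq> {0..n}" and "m \<le> k"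
  shows "card (nested_nsets A k m) \<le> k * n + 1"
proof -
  have "(\<lambda>(T, P). signed_sum int T P) ` nested_nsets A k m \<subseteq> {- int ((k - m) * n)..int (m * n)}"
  proof clarify
    fix T P assume "(T, P) \<in> nested_nsets A k m"
    then have sub: "P \<subseteq> T" "T \<subseteq> A" and card: "card P = m" "card (T - P) = k - m"
      by (auto simp: nested_nsets_def nsets_def card_Diff_subset)
    have bounded: "0 \<le> sum int S" "sum int S \<le> int (card S * n)" if "S \<subseteq> T" for S
    proof -
      have "S \<subseteq> {0..n}" using that sub A by blast
      then have "int i \<le> int n" if "i \<in> S" for i using that by auto
      then show "sum int S \<le> int (card S * n)"
        using sum_bounded_above[of S int "int n"] by simp
    qed (simp add: sum_nonneg)
    show "signed_sum int T P \<in> {- int ((k - m) * n)..int (m * n)}"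
      using sub bounded[of P] bounded[of "T - P"] unfolding card signed_sum_def by auto
  qed
  then have "card (nested_nsets A k m) \<le> card {- int ((k - m) * n)..int (m * n)}"
    using B_seq_inj_on_signed_sum[OF B \<open>m \<le> k\<close>] by (intro card_inj_on_le) auto
  also have "\<dots> = nat (int (k * n + 1))"
    using \<open>m \<le> k\<close> by (simp add: algebra_simps)
  finally show ?thesis by (simp only: nat_int)
qed

lemma B_seq_card_nested_nsets_square_le:
  assumes B: "B_seq k A" and A: "A \<subseteq> {0..n}" and "k \<ge> 3"
  shows "(real (card (nested_nsets A k (k div 2))))\<^sup>2 \<le> 8 * real ((k + 1) div 2) * (real n)\<^sup>2 + 1"
proof -
  define S h where "S = nested_nsets A k (k div 2)" and "h = (k + 1) div 2"
  define N c where "N = real (card S)" and "c = (2 * real (k div 2) - real k) * (real n / 2)"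
  let ?diff = "\<lambda>(T, P). signed_sum int T P"
  have fin: "finite A" using B by (simp add: B_seq_def)
  have inj: "inj_on ?diff S"
    unfolding S_def using B_seq_inj_on_signed_sum[OF B] by simp
  have half_width: "\<bar>real a - real n / 2\<bar> \<le> real n / 2" if "a \<in> A" for a
  proof -
    have "a \<le> n" using that A by auto
    then show ?thesis by linarith
  qed
  have "N * (N\<^sup>2 - 1) / 12 \<le> (\<Sum>s\<in>?diff ` S. (real_of_int s - c)\<^sup>2)"
    using sum_square_distinct_integers_ge[of "?diff ` S" c] finite_nested_nsets[OF fin] inj
    by (simp add: card_image N_def S_def)
  also have "\<dots> = (\<Sum>(T, P)\<in>S. (signed_sum real T P - c)\<^sup>2)"
    unfolding sum.reindex[OF inj] by (simp add: split_beta signed_sum_def)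
  also have "\<dots> \<le> N * (8 / 3 * real h * (real n / 2)\<^sup>2)"
    unfolding S_def N_def c_def h_def
    using fin \<open>k \<ge> 3\<close> half_width by (rule sum_square_centred_signed_sum_le)
  finally have "N * (N\<^sup>2 - 1) \<le> N * (8 * real h * (real n)\<^sup>2)"
    by (simp add: power_divide)
  then have "N = 0 \<or> N\<^sup>2 - 1 \<le> 8 * real h * (real n)\<^sup>2"
    by (auto simp: N_def mult_le_cancel_left)
  then show ?thesis by (auto simp: N_def S_def h_def)
qed

lemma B_seq_two_power_times_choose_le:
  assumes B: "B_seq k A" and A: "A \<subseteq> {0..n}" and "k \<ge> 1" "n \<ge> 1"
  shows "2 ^ k * real (card A choose k) \<le> 6 * real ((k + 1) div 2) * real n"
proof -
  define h N where "h = (k + 1) div 2" and "N = card (nested_nsets A k (k div 2))"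
  have N_eq: "N = (card A choose k) * (k choose (k div 2))"
    using B by (simp add: N_def B_seq_def card_nested_nsets)
  have "h \<ge> 1" using \<open>k \<ge> 1\<close> by (simp add: h_def)
  have N_square: "(real N)\<^sup>2 \<le> 9 * real h * (real n)\<^sup>2"
  proof (cases "k \<ge> 3")
    case True
    have "1 * 1 \<le> real h * (real n)\<^sup>2"
      using \<open>h \<ge> 1\<close> \<open>n \<ge> 1\<close> by (intro mult_mono) auto
    then show ?thesis
      using B_seq_card_nested_nsets_square_le[OF B A True] by (simp add: N_def h_def)
  next
    case False
    then have "k * n \<le> 2 * n" by (intro mult_right_mono) auto
    then have "N \<le> 3 * n"
      using B_seq_card_nested_nsets_le[OF B A div_le_dividend, of 2] \<open>n \<ge> 1\<close>
      unfolding N_def by linarith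
    then have "(real N)\<^sup>2 \<le> (3 * real n)\<^sup>2" by (intro power_mono) linarith+
    also have "\<dots> \<le> 9 * real h * (real n)\<^sup>2"
      using \<open>h \<ge> 1\<close> by (simp add: power_mult_distrib mult_right_mono)
    finally show ?thesis .
  qed
  have "(2 ^ k * real (card A choose k))\<^sup>2 = real (4 ^ k) * (real (card A choose k))\<^sup>2"
    by (simp add: power_mult_distrib power2_eq_square flip: power_mult_distrib)
  also have "\<dots> \<le> real (4 * h * (k choose (k div 2))\<^sup>2) * (real (card A choose k))\<^sup>2"
    unfolding h_def using \<open>k \<ge> 1\<close>
    by (intro mult_right_mono of_nat_mono choose_half_square_ge) auto
  also have "\<dots> = 4 * real h * (real N)\<^sup>2" by (simp add: N_eq power_mult_distrib)
  also have "\<dots> \<le> 4 * real h * (9 * real h * (real n)\<^sup>2)"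
    using N_square by (intro mult_left_mono) auto
  also have "\<dots> = (6 * real h * real n)\<^sup>2" by (simp add: power2_eq_square)
  finally show ?thesis unfolding h_def by (rule power2_le_imp_le) simp
qed

lemma B_seq_twice_excess_power_le:
  assumes B: "B_seq k A" and A: "A \<subseteq> {0..n}" and "k \<ge> 1" "n \<ge> 1"
  defines "t \<equiv> real (card A) - (exp 1 - 1) / exp 1 * real k"
  assumes "t \<ge> 0"
  shows "(2 * t) ^ k \<le> fact k * (6 * real ((k + 1) div 2) * real n)"
proof (cases "k \<le> card A")
  case True
  then have t_eq: "t = real (card A - k) + real k / exp 1"
    by (simp add: t_def field_simps)
  have "t ^ k \<le> fact k * real (card A choose k)"
    using power_le_fact_times_binomial[of "card A - k" k] True unfolding t_eq by simp
  then have "(2 * t) ^ k \<le> fact k * (2 ^ k * real (card A choose k))"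
    by (simp add: power_mult_distrib mult.left_commute)
  also have "\<dots> \<le> fact k * (6 * real ((k + 1) div 2) * real n)"
    using B_seq_two_power_times_choose_le[OF B A \<open>k \<ge> 1\<close> \<open>n \<ge> 1\<close>] by (intro mult_left_mono) auto
  finally show ?thesis .
next
  case False
  have t_eq: "t = real (card A) - real k + real k / exp 1"
    by (simp add: t_def field_simps)
  have k_e: "real k / exp 1 < real k" using \<open>k \<ge> 1\<close> by (simp add: divide_less_eq)
  then have "card A \<ge> 1" using t_eq \<open>t \<ge> 0\<close> by linarith
  then have "2 * t \<le> real (card A - 1) + real k / exp 1"
    using t_eq k_e False by simp
  then have "(2 * t) ^ k \<le> (real (card A - 1) + real k / exp 1) ^ k"
    using \<open>t \<ge> 0\<close> by (intro power_mono) auto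
  also have "\<dots> \<le> fact k * real ((card A + k - 1) choose k)"
    using power_le_fact_times_binomial[of "card A - 1" k] \<open>card A \<ge> 1\<close> by simp
  also have "\<dots> \<le> fact k * real (6 * ((k + 1) div 2) * n)"
  proof (intro mult_left_mono of_nat_mono)
    have "k * n \<le> 2 * ((k + 1) div 2) * n" by (intro mult_right_mono) auto
    moreover have "1 * 1 \<le> k * n" using \<open>k \<ge> 1\<close> \<open>n \<ge> 1\<close> by (intro mult_mono) auto
    ultimately show "(card A + k - 1) choose k \<le> 6 * ((k + 1) div 2) * n"
      using B_seq_multichoose_le[OF B A] by linarith
  qed simp
  finally show ?thesis by simp
qed

lemma exp_1_pi_square_ge: "24 \<le> exp 1 * pi\<^sup>2"
proof -
  have "8 / 3 \<le> exp (1 :: real)" using abs_le_D2[OF e_approx_32] by simp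
  then have "8 / 3 * 3\<^sup>2 \<le> exp 1 * pi\<^sup>2"
    using pi_gt3 by (intro mult_mono power_mono) auto
  then show ?thesis by simp
qed

lemma le_powr_inverse_if_power_le:
  fixes t y :: real
  assumes "k \<ge> 1" "y \<ge> 0" and power: "t \<ge> 0 \<Longrightarrow> t ^ k \<le> y"
  shows "t \<le> y powr (1 / real k)"
proof (cases "t \<ge> 0")
  case True
  then have "t = root k (t ^ k)" using assms by (simp add: real_root_power_cancel)
  also have "\<dots> \<le> root k y" using power True \<open>k \<ge> 1\<close> by simp
  also have "\<dots> = y powr (1 / real k)" using assms by (simp add: root_powr_inverse)
  finally show ?thesis .
next
  case False
  then show ?thesis using powr_ge_zero[of y "1 / real k"] by linarith
qed

lemma Phi_attained:
  obtains A where "A \<subseteq> {0..n}" "B_seq k A" "card A = Phi k n"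
proof -
  let ?S = "{card A | A. A \<subseteq> {0..n} \<and> B_seq k A}"
  have "?S \<subseteq> card ` Pow {0..n}" by auto
  then have "finite ?S" by (rule finite_subset) auto
  moreover have "card {} \<in> ?S" by (auto simp: B_seq_def intro!: exI[of _ "{}"])
  ultimately have "Phi k n \<in> ?S" unfolding Phi_def by (intro Max_in) auto
  then show ?thesis using that by auto
qed

theorem theorem5:
  fixes k n :: nat
  assumes "k \<ge> 1" and "n \<ge> 1"
  shows "real (Phi k n) \<le>
    (exp 1 * pi^2 * real ((k + 1) div 2) * fact k / 2^(k+2)) powr (1 / real k) * real n powr (1 / real k)
    + (exp 1 - 1) / exp 1 * real k"
proof -
  obtain A where A: "A \<subseteq> {0..n}" "B_seq k A" "card A = Phi k n" by (rule Phi_attained)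
  define X where "X = exp 1 * pi^2 * real ((k + 1) div 2) * fact k / 2^(k+2)"
  define t where "t = real (card A) - (exp 1 - 1) / exp 1 * real k"
  have "X \<ge> 0" by (simp add: X_def)
  have "t ^ k \<le> X * real n" if "t \<ge> 0"
  proof -
    have "4 * (2 * t) ^ k \<le> 24 * (fact k * real ((k + 1) div 2) * real n)"
      using B_seq_twice_excess_power_le[OF A(2,1) assms, folded t_def, OF that] by (simp add: mult_ac)
    also have "\<dots> \<le> exp 1 * pi\<^sup>2 * (fact k * real ((k + 1) div 2) * real n)"
      using exp_1_pi_square_ge by (intro mult_right_mono) auto
    finally show ?thesis by (simp add: X_def field_simps)
  qed
  then have "t \<le> (X * real n) powr (1 / real k)"
    using \<open>X \<ge> 0\<close> assms by (intro le_powr_inverse_if_power_le) auto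
  also have "\<dots> = X powr (1 / real k) * real n powr (1 / real k)"
    using \<open>X \<ge> 0\<close> by (simp add: powr_mult)
  finally show ?thesis using A(3) unfolding t_def X_def by simp
qed

end
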